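(* Let the columns of $V_r$ and $\widehat V_r$ be exact and approximate solutions, respectively, of $K(\sigma_j)v_j=B(\sigma_j)b_j$, $j=1,\dots,r$, and let the columns of $W_r$ and $\widehat W_r$ be exact and approximate solutions, respectively, of $w_i^TK(\mu_i)=c_i^TC(\mu_i)$, $i=1,\dots,r$. Let $H_r$ be the reduced model obtained from $(V_r,W_r)$ and $\widehat H_r$ the reduced model obtained from $(\widehat V_r,\widehat W_r)$, with associated subspaces $\mathcal V_r,\mathcal W_r,\widehat{\mathcal V}_r,\widehat{\mathcal W}_r$. Then $$\frac{\|H_r-\widehat H_r\|_{\mathcal H_\infty}}{\frac12\big(\|H_r\|_{\mathcal H_\infty}+\|\widehat H_r\|_{\mathcal H_\infty}\big)}\le M\,\max\big(\sin\Theta(\widehat{\mathcal V}_r,\mathcal V_r),\ \sin\Theta(\widehat{\mathcal W}_r,\mathcal W_r)\big),$$ where $$M=2\max\left(\frac{\max_{\omega\in\mathbb{R}}\mathrm{cond}_C(H_r(\imath\omega))}{\min_{\omega\in\mathbb{R}}\cos\Theta(\widehat{\mathfrak Q}_r(\imath\omega),\widehat{\mathcal V}_r)},\ \frac{\max_{\omega\in\mathbb{R}}\mathrm{cond}_B(\widehat H_r(\imath\omega))}{\min_{\omega\in\mathbb{R}}\cos\Theta(\mathfrak P_r(\imath\omega),\mathcal W_r)}\right)$$ and $$\mathrm{cond}_B(\widehat H_r(s))=\frac{\|\widehat C_r(s)\widehat K_r(s)^{-1}\widehat W_r^T\|\,\|B(s)\|}{\|\widehat H_r(s)\|},\qquad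 \mathrm{cond}_C(H_r(s))=\frac{\|C(s)\|\,\|V_rK_r(s)^{-1}B_r(s)\|}{\|H_r(s)\|}.$$
   Context: $K(s)\in\mathbb{C}^{n\times n}$, $B(s)\in\mathbb{C}^{n\times m}$, $C(s)\in\mathbb{C}^{p\times n}$ are matrix-valued functions defined on the imaginary axis and at the points $\sigma_j,\mu_i\in\mathbb{C}$, with $K$ nonsingular there; $b_j\in\mathbb{C}^m$, $c_i\in\mathbb{C}^p$. "Approximate solutions" may be any vectors; each of $V_r,\widehat V_r,W_r,\widehat W_r\in\mathbb{C}^{n\times r}$ is assumed to have linearly independent columns. Reduced models: $K_r(s)=W_r^TK(s)V_r$, $B_r(s)=W_r^TB(s)$, $C_r(s)=C(s)V_r$, $H_r(s)=C_r(s)K_r(s)^{-1}B_r(s)$; and $\widehat K_r(s)=\widehat W_r^TK(s)\widehat V_r$, $\widehat B_r(s)=\widehat W_r^TB(s)$, $\widehat C_r(s)=C(s)\widehat V_r$, $\widehat H_r(s)=\widehat C_r(s)\widehat K_r(s)^{-1}\widehat B_r(s)$. Implicit assumptions so that all quantities in the statement are defined: for every $\omega\in\mathbb{R}$, $K_r(\imath\omega)$ and $\widehat K_r(\imath\omega)$ are nonsingular and $H_r(\imath\omega)\neq0$, $\widehat H_r(\imath\omega)\ne0$; the norms $\|H_r\|_{\mathcal H_\infty},\|\widehat H_r\|_{\mathcal H_\infty}$ and the constant $M$ are finite. Here $\max$ and $\min$ over $\omega\in\mathbb{R}$ are understood as supremum and infimum, and $\|G\|_{\mathcal H_\infty}=\sup_{\omega\in\mathbb{R}}\|G(\imath\omega)\|$.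 $\|\cdot\|$ is the Euclidean / spectral norm; $^T$ is transpose without conjugation; orthogonal complements are with respect to the standard Hermitian inner product. Subspaces: $\mathcal V_r=\mathrm{Ran}\,V_r$, $\widehat{\mathcal V}_r=\mathrm{Ran}\,\widehat V_r$, $\mathcal W_r=\mathrm{Ker}(W_r^T)^\perp$, $\widehat{\mathcal W}_r=\mathrm{Ker}(\widehat W_r^T)^\perp$ (i.e. spans of the entrywise conjugated columns of $W_r$, $\widehat W_r$), $\mathfrak P_r(s)=\mathrm{Ran}(K(s)V_r)$, $\widehat{\mathfrak Q}_r(s)=\mathrm{Ker}(\widehat W_r^TK(s))^\perp$. For subspaces $\mathcal M,\mathcal N$ of $\mathbb{C}^n$, $\Theta(\mathcal M,\mathcal N)\in[0,\pi/2]$ is defined by $\sin\Theta(\mathcal M,\mathcal N)=\sup_{0\ne x\in\mathcal M}\inf_{y\in\mathcal N}\|y-x\|/\|x\|$. *)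

theory Defs
  imports "HOL-Analysis.Analysis"
begin

text \<open>A complex matrix with \<open>p\<close> rows and \<open>n\<close> columns has type \<^typ>\<open>complex^'n^'p\<close>.
  The norm of \<^typ>\<open>complex^'n\<close> is the Euclidean one, so the operator norm below is the
  spectral norm.\<close>

definition spectral_norm :: "complex^'n^'p \<Rightarrow> real" where
  "spectral_norm A = onorm ((*v) A)"

text \<open>The supremum is taken over the imaginary axis only; for real suprema to be meaningful the
  set of values has to be bounded above.\<close>

definition hinf_norm :: "(complex \<Rightarrow> complex^'m^'p) \<Rightarrow> real" where
  "hinf_norm G = (SUP \<omega>::real. spectral_norm (G (\<i> * of_real \<omega>)))"

text \<open>Linear independence of the columns as a family, so repeated columns are excluded.\<close>

definition independent_columns :: "complex^'r^'n \<Rightarrow> bool" where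
  "independent_columns A \<longleftrightarrow>
     (\<forall>a. (\<Sum>j\<in>UNIV. a j *s column j A) = 0 \<longrightarrow> (\<forall>j. a j = 0))"


section \<open>Subspaces and angles\<close>

definition Ran :: "complex^'r^'n \<Rightarrow> (complex^'n) set" where
  "Ran A = range ((*v) A)"

definition Ker :: "complex^'n^'r \<Rightarrow> (complex^'n) set" where
  "Ker A = {x. A *v x = 0}"

definition hermitian_inner :: "complex^'n \<Rightarrow> complex^'n \<Rightarrow> complex" where
  "hermitian_inner x y = (\<Sum>i\<in>UNIV. x $ i * cnj (y $ i))"

definition orth_compl :: "(complex^'n) set \<Rightarrow> (complex^'n) set" where
  "orth_compl S = {x. \<forall>y\<in>S. hermitian_inner x y = 0}"

text \<open>The sine of the angle lies in \<open>[0,1]\<close> for all subspaces, hence \<^const>\<open>arcsin\<close> gives the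
  angle in \<open>[0, \<pi>/2]\<close>. The supremum over the empty set (zero subspace \<open>M\<close>) is read as
  \<open>0\<close>.\<close>

definition subspace_angle :: "(complex^'n) set \<Rightarrow> (complex^'n) set \<Rightarrow> real" where
  "subspace_angle M N =
     arcsin (if M \<subseteq> {0} then 0
             else (SUP x\<in>M - {0}. INF y\<in>N. norm (y - x) / norm x))"


section \<open>Petrov--Galerkin reduced models\<close>

text \<open>\<^const>\<open>transpose\<close> does not conjugate.\<close>

definition red_K ::
  "(complex \<Rightarrow> complex^'n^'n) \<Rightarrow> complex^'r^'n \<Rightarrow> complex^'r^'n \<Rightarrow> complex \<Rightarrow> complex^'r^'r" where
  "red_K K V W s = transpose W ** K s ** V"

definition red_B ::
  "(complex \<Rightarrow> complex^'m^'n) \<Rightarrow> complex^'r^'n \<Rightarrow> complex \<Rightarrow> complex^'m^'r" where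
  "red_B B W s = transpose W ** B s"

definition red_C ::
  "(complex \<Rightarrow> complex^'n^'p) \<Rightarrow> complex^'r^'n \<Rightarrow> complex \<Rightarrow> complex^'r^'p" where
  "red_C C V s = C s ** V"

definition red_H ::
  "(complex \<Rightarrow> complex^'n^'n) \<Rightarrow> (complex \<Rightarrow> complex^'m^'n) \<Rightarrow> (complex \<Rightarrow> complex^'n^'p) \<Rightarrow>
   complex^'r^'n \<Rightarrow> complex^'r^'n \<Rightarrow> complex \<Rightarrow> complex^'m^'p" where
  "red_H K B C V W s = red_C C V s ** matrix_inv (red_K K V W s) ** red_B B W s"

definition cond_B ::
  "(complex \<Rightarrow> complex^'n^'n) \<Rightarrow> (complex \<Rightarrow> complex^'m^'n) \<Rightarrow> (complex \<Rightarrow> complex^'n^'p) \<Rightarrow>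
   complex^'r^'n \<Rightarrow> complex^'r^'n \<Rightarrow> complex \<Rightarrow> real" where
  "cond_B K B C V W s =
     spectral_norm (red_C C V s ** matrix_inv (red_K K V W s) ** transpose W) * spectral_norm (B s)
       / spectral_norm (red_H K B C V W s)"

definition cond_C ::
  "(complex \<Rightarrow> complex^'n^'n) \<Rightarrow> (complex \<Rightarrow> complex^'m^'n) \<Rightarrow> (complex \<Rightarrow> complex^'n^'p) \<Rightarrow>
   complex^'r^'n \<Rightarrow> complex^'r^'n \<Rightarrow> complex \<Rightarrow> real" where
  "cond_C K B C V W s =
     spectral_norm (C s) * spectral_norm (V ** matrix_inv (red_K K V W s) ** red_B B W s)
       / spectral_norm (red_H K B C V W s)"

definition left_space :: "complex^'r^'n \<Rightarrow> (complex^'n) set" where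
  "left_space W = orth_compl (Ker (transpose W))"

definition frak_P :: "(complex \<Rightarrow> complex^'n^'n) \<Rightarrow> complex^'r^'n \<Rightarrow> complex \<Rightarrow> (complex^'n) set" where
  "frak_P K V s = Ran (K s ** V)"

definition frak_Q :: "(complex \<Rightarrow> complex^'n^'n) \<Rightarrow> complex^'r^'n \<Rightarrow> complex \<Rightarrow> (complex^'n) set" where
  "frak_Q K W s = orth_compl (Ker (transpose W ** K s))"

end

theory Submission
  imports Defs
begin

text \<open>At a fixed point \<open>s\<close> put \<open>X = V K\<^sub>r\<^sup>-\<^sup>1 W\<^sup>T\<close> and let \<open>X'\<close> be its analogue for \<open>V', W'\<close>. Then
  \<open>X - X' = (1 - X' K) X - X' (1 - K X)\<close>, where \<open>X' K\<close> and \<open>K X\<close> are oblique projections. The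
  cosines bound the norms of the complementary projections. The first one is applied to \<open>Ran V\<close>
  only and vanishes on \<open>Ran V'\<close>; the second one takes values in \<open>Ker W\<^sup>T\<close>, and \<open>X'\<close> vanishes on
  \<open>Ker W'\<^sup>T\<close>; this brings in the sines. The angle between \<open>Ran V\<close> and \<open>Ran V'\<close> enters in the
  reversed order, which is harmless because the dimensions agree. All of this takes place in
  the underlying real Euclidean space, since a complex subspace has the same orthogonal complement
  for the Hermitian and for the real inner product.\<close>

section \<open>Hermitian and real orthogonality, ranges and kernels\<close>

lemma Re_hermitian_inner: "Re (hermitian_inner x y) = inner x y"
  by (simp add: hermitian_inner_def inner_vec_def inner_complex_def)

lemma hermitian_inner_scale_right: "hermitian_inner x (a *s y) = cnj a * hermitian_inner x y"
  by (simp add: hermitian_inner_def sum_distrib_left mult_ac)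

text \<open>The imaginary part of \<open>hermitian_inner x y\<close> is the real inner product of
  \<open>x\<close> with \<open>\<i> *s y\<close>, so closure of \<open>S\<close> under
  multiplication by \<open>\<i>\<close> lets the real condition imply the Hermitian one.\<close>

lemma mem_orth_compl_iff:
  assumes S: "\<And>y. y \<in> S \<Longrightarrow> \<i> *s y \<in> S"
  shows "x \<in> orth_compl S \<longleftrightarrow> (\<forall>y\<in>S. inner x y = 0)"
proof
  assume "x \<in> orth_compl S"
  then show "\<forall>y\<in>S. inner x y = 0"
    by (simp add: orth_compl_def flip: Re_hermitian_inner)
next
  assume R: "\<forall>y\<in>S. inner x y = 0"
  have "hermitian_inner x y = 0" if y: "y \<in> S" for y
  proof (rule complex_eqI)
    show "Re (hermitian_inner x y) = Re 0"
      using R y by (simp add: Re_hermitian_inner)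
    have "inner x (\<i> *s y) = 0"
      using R S y by blast
    then show "Im (hermitian_inner x y) = Im 0"
      by (simp add: hermitian_inner_scale_right flip: Re_hermitian_inner)
  qed
  then show "x \<in> orth_compl S"
    by (simp add: orth_compl_def)
qed

lemma mem_orth_compl_Ker_iff:
  "x \<in> orth_compl (Ker A) \<longleftrightarrow> (\<forall>y. A *v y = 0 \<longrightarrow> inner x y = 0)"
proof -
  have "\<And>y. y \<in> Ker A \<Longrightarrow> \<i> *s y \<in> Ker A"
    by (simp add: Ker_def vec.scale)
  then show ?thesis
    by (simp add: mem_orth_compl_iff) (auto simp: Ker_def)
qed

lemma subspace_Ran: "subspace (Ran A)"
  unfolding Ran_def by (intro linear_subspace_image) auto

lemma subspace_Ker: "subspace (Ker A)"
  unfolding Ker_def by (intro linear_subspace_kernel) auto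

lemma subspace_orth_compl_Ker: "subspace (orth_compl (Ker A))"
  by (rule subspaceI) (auto simp: mem_orth_compl_Ker_iff inner_add_left)

text \<open>Independence makes multiplication by \<open>A\<close> injective. The dimension is the
  real one, twice the number of columns; it serves to equate those of \<open>Ran V\<close> and
  \<open>Ran V'\<close>.\<close>

lemma dim_Ran:
  fixes A :: "complex^'r^'n"
  assumes "independent_columns A"
  shows "dim (Ran A) = DIM(complex^'r)"
proof -
  have "x = 0" if "A *v x = 0" for x
  proof -
    have "(\<Sum>j\<in>UNIV. x $ j *s column j A) = 0"
      using that by (simp add: matrix_mult_sum)
    then show ?thesis
      using assms by (simp add: independent_columns_def vec_eq_iff)
  qed
  then have "inj ((*v) A)"
    by (subst linear_injective_0) auto
  then show ?thesis
    unfolding Ran_def by (subst dim_image_eq) (auto intro: inj_on_subset)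
qed


section \<open>Gaps between subspaces\<close>

text \<open>The point 0 of \<open>N\<close> bounds each infimum by 1, so the defining supremum lies
  in [0,1] and \<open>sin\<close> undoes \<open>arcsin\<close>. The infimum is attained at the
  orthogonal projection onto \<open>N\<close>, which supplies the nearby point.\<close>

lemma subspace_angle_gap:
  fixes M N :: "(complex^'n) set"
  assumes M: "subspace M" and N: "subspace N"
  shows sin_subspace_angle_nonneg: "0 \<le> sin (subspace_angle M N)"
    and cos_subspace_angle_nonneg: "0 \<le> cos (subspace_angle M N)"
    and ex_near_subspace_angle:
      "x \<in> M \<Longrightarrow> \<exists>y\<in>N. norm (x - y) \<le> sin (subspace_angle M N) * norm x"
proof -
  define f where "f = (\<lambda>x. INF y\<in>N. norm (y - x) / norm x)"
  define s where "s = (if M \<subseteq> {0} then 0 else (SUP x\<in>M - {0}. f x))"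
  have bdd: "bdd_below ((\<lambda>y. norm (y - x) / norm x) ` N)" for x
    by (rule bdd_belowI2[of _ 0]) simp
  have f0: "0 \<le> f x" for x
    unfolding f_def using subspace_0[OF N] by (intro cINF_greatest) auto
  have f1: "f x \<le> 1" for x
  proof -
    have "f x \<le> norm (0 - x) / norm x"
      unfolding f_def using subspace_0[OF N] bdd by (rule cINF_lower[rotated])
    also have "\<dots> \<le> 1" by (simp add: divide_le_eq_1)
    finally show ?thesis .
  qed
  have fs: "f x \<le> s" if "x \<in> M" "x \<noteq> 0" for x
  proof -
    have "f x \<le> (SUP x\<in>M - {0}. f x)"
      using that f1 by (intro cSUP_upper bdd_aboveI2[of _ _ 1]) auto
    then show ?thesis
      using that by (auto simp: s_def)
  qed
  have s01: "0 \<le> s" "s \<le> 1"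
  proof -
    show "0 \<le> s"
    proof (cases "M \<subseteq> {0}")
      case False
      then obtain x where "x \<in> M" "x \<noteq> 0" by auto
      then show ?thesis using fs f0 order_trans by blast
    qed (simp add: s_def)
    show "s \<le> 1"
      unfolding s_def using f1 by (auto intro!: cSUP_least)
  qed
  have angle: "subspace_angle M N = arcsin s"
    by (simp add: subspace_angle_def s_def f_def)
  show "0 \<le> sin (subspace_angle M N)" "0 \<le> cos (subspace_angle M N)"
    using s01 by (auto simp: angle cos_arcsin power_le_one)
  show "\<exists>y\<in>N. norm (x - y) \<le> sin (subspace_angle M N) * norm x" if x: "x \<in> M"
  proof (cases "x = 0")
    case True
    then show ?thesis using subspace_0[OF N] by auto
  next
    case False
    obtain y z where y: "y \<in> span N" and z: "\<And>w. w \<in> span N \<Longrightarrow> orthogonal z w"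
      and xyz: "x = y + z"
      using orthogonal_subspace_decomp_exists by blast
    have yN: "y \<in> N" using y N span_eq_iff by metis
    have "norm z / norm x \<le> f x"
      unfolding f_def
    proof (rule cINF_greatest)
      fix w assume w: "w \<in> N"
      have "orthogonal z (y - w)"
        using y span_base[OF w] by (intro z span_diff)
      then have "norm (y - w + z) ^ 2 = norm (y - w) ^ 2 + norm z ^ 2"
        by (intro norm_add_Pythagorean) (simp add: orthogonal_commute)
      moreover have wx: "norm (w - x) = norm (y - w + z)"
        by (subst norm_minus_commute) (simp add: xyz algebra_simps)
      ultimately have "norm z ^ 2 \<le> norm (w - x) ^ 2"
        unfolding wx by simp
      then have "norm z \<le> norm (w - x)"
        by (rule power2_le_imp_le) simp
      then show "norm z / norm x \<le> norm (w - x) / norm x"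
        by (simp add: divide_right_mono)
    qed (use yN in auto)
    also have "\<dots> \<le> s" using fs x False by blast
    finally have "norm z \<le> s * norm x"
      using False by (simp add: divide_le_eq)
    then have "norm (x - y) \<le> sin (subspace_angle M N) * norm x"
      using s01 by (simp add: angle xyz)
    then show ?thesis using yN by blast
  qed
qed

text \<open>Equality of dimensions makes \<open>N\<close> a complement of the orthogonal complement of \<open>M\<close>, so that
  every point of \<open>M\<close> is the orthogonal projection of a point of \<open>N\<close>.\<close>

lemma gap_symmetric:
  fixes M N :: "'a::euclidean_space set"
  assumes M: "subspace M" and N: "subspace N" and dim: "dim M = dim N"
    and near: "\<And>y. y \<in> N \<Longrightarrow> \<exists>x\<in>M. norm (y - x) \<le> s * norm y"
    and x: "x \<in> M"
  shows "\<exists>y\<in>N. norm (x - y) \<le> s * norm x"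
proof (cases "s < 1")
  case False
  then have "norm x \<le> s * norm x"
    by (simp add: mult_le_cancel_right1)
  then show ?thesis
    using subspace_0[OF N] by (intro bexI[of _ 0]) auto
next
  case True
  define M' where "M' = {z. \<forall>x\<in>M. orthogonal x z}"
  have M': "subspace M'"
    unfolding M'_def by (rule subspace_orthogonal_to_vectors)
  have dimM': "dim M' + dim M = DIM('a)"
    using dim_subspace_orthogonal_to_vectors[of M UNIV] M by (simp add: M'_def)
  \<comment> \<open>Here \<open>z\<close> is the part of \<open>y\<close> orthogonal to
    \<open>M\<close>, so its norm is the distance from \<open>y\<close> to \<open>M\<close> and
    cannot exceed the distance to \<open>v\<close>.\<close>
  have near0: "norm z \<le> s * norm y" if "y \<in> N" "y = u + z" "u \<in> M" "z \<in> M'" for y u z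
  proof -
    obtain v where v: "v \<in> M" "norm (y - v) \<le> s * norm y"
      using near \<open>y \<in> N\<close> by blast
    have "orthogonal (u - v) z"
      using \<open>z \<in> M'\<close> subspace_diff[OF M \<open>u \<in> M\<close> v(1)] by (simp add: M'_def)
    then have "norm (u - v + z) ^ 2 = norm (u - v) ^ 2 + norm z ^ 2"
      by (rule norm_add_Pythagorean)
    moreover have yv: "y - v = u - v + z" using that by simp
    ultimately have "norm z ^ 2 \<le> norm (y - v) ^ 2"
      unfolding yv by simp
    then have "norm z \<le> norm (y - v)"
      by (rule power2_le_imp_le) simp
    with v show ?thesis by simp
  qed
  \<comment> \<open>A vector orthogonal to \<open>M\<close> has its own norm as distance to
    \<open>M\<close>, which \<open>s < 1\<close> excludes unless it vanishes.\<close>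
  have "N \<inter> M' \<subseteq> {0}"
  proof
    fix y assume "y \<in> N \<inter> M'"
    then have "norm y \<le> s * norm y"
      using near0[of y 0 y] subspace_0[OF M] by simp
    then show "y \<in> {0}"
      using True by (simp add: mult_le_cancel_right1)
  qed
  then have "dim (N \<inter> M') = 0"
    by (simp only: dim_eq_0)
  define U where "U = {y + z |y z. y \<in> N \<and> z \<in> M'}"
  have "dim U = DIM('a)"
    using dim_sums_Int[OF N M'] dim dimM' \<open>dim (N \<inter> M') = 0\<close> by (simp add: U_def)
  then have "span U = UNIV"
    by (simp only: dim_eq_full)
  moreover have "subspace U"
    unfolding U_def by (rule subspace_sums[OF N M'])
  ultimately have "U = UNIV"
    using span_eq_iff[of U] by simp
  then have "x \<in> U"
    by simp
  then obtain y z where y: "y \<in> N" and z: "z \<in> M'" and xyz: "x = y + z"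
    unfolding U_def by blast
  have mz: "- z \<in> M'" using M' z by (rule subspace_neg)
  have yxz: "y = x + - z" using xyz by simp
  have xz: "inner x z = 0"
    using x z by (auto simp: M'_def orthogonal_def)
  have "norm z \<le> s * norm y"
    using near0[OF y yxz x mz] by simp
  then have "norm z ^ 2 \<le> (s * norm y) ^ 2"
    by (rule power_mono) simp
  then have zs: "norm z ^ 2 \<le> s ^ 2 * norm y ^ 2"
    by (simp add: power_mult_distrib)
  have "orthogonal x (- z)"
    using xz by (simp add: orthogonal_def)
  then have yn: "norm y ^ 2 = norm x ^ 2 + norm z ^ 2"
    by (simp add: yxz norm_add_Pythagorean del: add_uminus_conv_diff)
  show ?thesis
  proof (cases "y = 0")
    case True
    then show ?thesis using yn y by auto
  next
    case False
    \<comment> \<open>Since \<open>inner x y = norm x ^ 2\<close>, the vector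
      \<open>t *\<^sub>R y\<close> is the orthogonal projection of \<open>x\<close> onto the line
      through \<open>y\<close>. The right triangle with sides \<open>x\<close>, \<open>z\<close> and
      \<open>y\<close> gives both distances the same relative size.\<close>
    define t where "t = norm x ^ 2 / norm y ^ 2"
    have s0: "0 \<le> s"
      using \<open>norm z \<le> s * norm y\<close> False
      by (meson norm_ge_zero order_trans zero_le_mult_iff zero_less_norm_iff not_le)
    have xy: "inner x y = norm x ^ 2"
      by (simp add: yxz inner_diff_right xz power2_norm_eq_inner)
    have "norm (x - t *\<^sub>R y) ^ 2 = inner x x - 2 * t * inner x y + t ^ 2 * inner y y"
      unfolding power2_norm_eq_inner
      by (simp add: inner_diff_left inner_diff_right inner_commute[of y x]
          power2_eq_square algebra_simps)
    also have "\<dots> = norm x ^ 2 - 2 * t * norm x ^ 2 + t ^ 2 * norm y ^ 2"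
      by (simp only: xy flip: power2_norm_eq_inner)
    also have "t ^ 2 * norm y ^ 2 = t * norm x ^ 2"
      using False by (simp add: t_def power2_eq_square)
    also have "norm x ^ 2 - 2 * t * norm x ^ 2 + t * norm x ^ 2 = norm x ^ 2 * (1 - t)"
      by (simp add: algebra_simps)
    also have "1 - t = norm z ^ 2 / norm y ^ 2"
    proof -
      have "norm x ^ 2 = norm y ^ 2 - norm z ^ 2" using yn by simp
      then show ?thesis using False by (simp add: t_def diff_divide_distrib)
    qed
    also have "norm x ^ 2 * (norm z ^ 2 / norm y ^ 2) \<le> norm x ^ 2 * s ^ 2"
      using zs False by (intro mult_left_mono) (auto simp: divide_le_eq)
    finally have "norm (x - t *\<^sub>R y) ^ 2 \<le> (s * norm x) ^ 2"
      by (simp add: power_mult_distrib mult.commute)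
    then have "norm (x - t *\<^sub>R y) \<le> s * norm x"
      by (rule power2_le_imp_le) (simp add: s0)
    then show ?thesis using subspace_scale[OF N y] by blast
  qed
qed

section \<open>Cosines as bounds for complementary projections\<close>

text \<open>As \<open>e\<close> is orthogonal to \<open>N\<close> and \<open>p\<close> is close to
  \<open>N\<close>, the product \<open>inner e p\<close> can be negative only up to the sine times
  both norms. Completing the square in \<open>norm p\<close> then leaves the squared cosine times
  \<open>norm e ^ 2\<close>.\<close>

lemma cos_angle_mult_norm_le:
  fixes M N :: "(complex^'n) set"
  assumes M: "subspace M" and N: "subspace N"
    and e: "\<And>y. y \<in> N \<Longrightarrow> inner e y = 0" and p: "p \<in> M"
  shows "cos (subspace_angle M N) * norm e \<le> norm (e + p)"
proof -
  let ?\<theta> = "subspace_angle M N"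
  obtain y where y: "y \<in> N" "norm (p - y) \<le> sin ?\<theta> * norm p"
    using ex_near_subspace_angle[OF M N p] by blast
  have "\<bar>inner e p\<bar> = \<bar>inner e (p - y)\<bar>"
    using e[OF y(1)] by (simp add: inner_diff_right)
  also have "\<dots> \<le> norm e * norm (p - y)"
    by (rule Cauchy_Schwarz_ineq2)
  also have "\<dots> \<le> norm e * (sin ?\<theta> * norm p)"
    using y by (intro mult_left_mono) auto
  finally have ep: "- (norm e * (sin ?\<theta> * norm p)) \<le> inner e p" by simp
  have "(cos ?\<theta> * norm e) ^ 2 \<le> (cos ?\<theta> * norm e) ^ 2 + (sin ?\<theta> * norm e - norm p) ^ 2"
    by simp
  also have "\<dots> = (sin ?\<theta> ^ 2 + cos ?\<theta> ^ 2) * norm e ^ 2 - 2 * (norm e * (sin ?\<theta> * norm p)) + norm p ^ 2"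
    by algebra
  also have "\<dots> \<le> norm e ^ 2 + 2 * inner e p + norm p ^ 2"
    unfolding sin_cos_squared_add using ep by linarith
  also have "\<dots> = norm (e + p) ^ 2"
    by (simp add: power2_norm_eq_inner inner_add inner_commute)
  finally show ?thesis by (rule power2_le_imp_le) simp
qed

text \<open>The adjoint of \<open>T\<close> is the complementary projection: its values are orthogonal to \<open>N\<close> and
  differ from the argument by elements of \<open>M\<close>.\<close>

lemma norm_oblique_projection_le:
  fixes T :: "complex^'n \<Rightarrow> complex^'n"
  assumes T: "linear T" and M: "subspace M" and N: "subspace N"
    and T0: "\<And>v. v \<in> N \<Longrightarrow> T v = 0"
    and TM: "\<And>u. (\<And>k. T k = k \<Longrightarrow> inner u k = 0) \<Longrightarrow> u \<in> M"
    and c: "0 < cos (subspace_angle M N)"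
  shows "norm (T x) \<le> norm x / cos (subspace_angle M N)"
proof (cases "T x = 0")
  case False
  let ?c = "cos (subspace_angle M N)"
  define u where "u = T x"
  have "inner (adjoint T u) y = 0" if "y \<in> N" for y
    using adjoint_works[OF T, of y u] T0[OF that] by (simp add: inner_commute)
  moreover have "u - adjoint T u \<in> M"
  proof (rule TM)
    fix k assume "T k = k"
    then show "inner (u - adjoint T u) k = 0"
      using adjoint_works[OF T, of k u] by (simp add: inner_diff_left inner_diff_right inner_commute)
  qed
  ultimately have "?c * norm (adjoint T u) \<le> norm (adjoint T u + (u - adjoint T u))"
    by (rule cos_angle_mult_norm_le[OF M N])
  then have le: "?c * norm (adjoint T u) \<le> norm u"
    by simp
  \<comment> \<open>Moving \<open>T\<close> across the inner product turns the bound for the adjoint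
    at \<open>u = T x\<close> into one for \<open>T\<close> at \<open>x\<close>.\<close>
  have "norm u * norm u = inner x (adjoint T u)"
    using adjoint_works[OF T, of x u] by (simp add: u_def dot_square_norm power2_eq_square)
  also have "\<dots> \<le> norm x * norm (adjoint T u)"
    by (rule norm_cauchy_schwarz)
  also have "\<dots> \<le> norm x * (norm u / ?c)"
    using le c by (intro mult_left_mono) (auto simp: field_simps)
  finally have "norm u * norm u \<le> (norm x / ?c) * norm u" by simp
  then have "norm u \<le> norm x / ?c"
    using False by (subst (asm) mult_le_cancel_right_pos) (simp_all add: u_def)
  then show ?thesis by (simp add: u_def)
qed (use c in simp)


section \<open>The pointwise estimate\<close>

declare transpose_matrix_vector [simp del]

lemma norm_matrix_vector_mult_le:
  fixes A :: "complex^'n^'p"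
  shows "norm (A *v x) \<le> spectral_norm A * norm x"
  unfolding spectral_norm_def by (intro onorm matrix_vector_mul_bounded_linear)

lemma spectral_norm_le:
  fixes A :: "complex^'n^'p"
  assumes "\<And>x. norm (A *v x) \<le> b * norm x"
  shows "spectral_norm A \<le> b"
  unfolding spectral_norm_def using assms by (rule onorm_le)

lemma spectral_norm_nonneg: "0 \<le> spectral_norm (A :: complex^'n^'p)"
  unfolding spectral_norm_def by (intro onorm_pos_le matrix_vector_mul_bounded_linear)

lemma spectral_norm_pos:
  fixes A :: "complex^'n^'p"
  assumes "A \<noteq> 0"
  shows "0 < spectral_norm A"
proof -
  have "\<not> (\<forall>x. A *v x = 0)"
    using assms by (auto simp: matrix_eq)
  then show ?thesis
    unfolding spectral_norm_def by (simp add: onorm_pos_lt)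
qed

lemma matrix_inv_mult:
  assumes "invertible A"
  shows "A ** matrix_inv A = mat 1 \<and> matrix_inv A ** A = mat 1"
  unfolding matrix_inv_def by (rule someI_ex) (use assms in \<open>simp add: invertible_def\<close>)

lemma matrix_inv_vector_mult:
  assumes "invertible A"
  shows "A *v (matrix_inv A *v x) = x" "matrix_inv A *v (A *v x) = x"
  using matrix_inv_mult[OF assms] by (simp_all add: matrix_vector_mul_assoc)

text \<open>The identity for \<open>X - X'\<close>, multiplied by \<open>C s\<close> on the left and
  \<open>B s\<close> on the right, splits the error into two terms, each the product of a condition
  number, an inverse cosine, a sine and the norm of one reduced model.\<close>

lemma spectral_norm_red_H_diff_le:
  fixes K :: "complex \<Rightarrow> complex^'n^'n"
    and B :: "complex \<Rightarrow> complex^'m^'n"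
    and C :: "complex \<Rightarrow> complex^'n^'p"
    and V V' W W' :: "complex^'r^'n"
  assumes indep: "independent_columns V" "independent_columns V'"
    and Kr: "invertible (red_K K V W s)"
    and Kr': "invertible (red_K K V' W' s)"
    and H: "red_H K B C V W s \<noteq> 0"
    and H': "red_H K B C V' W' s \<noteq> 0"
    and cos_Q: "0 < cos (subspace_angle (frak_Q K W' s) (Ran V'))"
    and cos_P: "0 < cos (subspace_angle (frak_P K V s) (left_space W))"
  shows "spectral_norm (red_H K B C V W s - red_H K B C V' W' s)
    \<le> cond_C K B C V W s / cos (subspace_angle (frak_Q K W' s) (Ran V'))
        * sin (subspace_angle (Ran V') (Ran V)) * spectral_norm (red_H K B C V W s)
      + cond_B K B C V' W' s / cos (subspace_angle (frak_P K V s) (left_space W))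
        * sin (subspace_angle (left_space W') (left_space W)) * spectral_norm (red_H K B C V' W' s)"
    (is "_ \<le> ?cC / ?cQ * ?sV * ?H + ?cB / ?cP * ?sW * ?H'")
proof -
  \<comment> \<open>In the notation below, \<open>L\<close> is \<open>X\<close> after
    \<open>B s\<close> and \<open>R\<close> is \<open>C s\<close> after \<open>X'\<close>. Their
    norms are the factors in \<open>cond_C\<close> and \<open>cond_B\<close>.\<close>
  define L where "L = V ** matrix_inv (red_K K V W s) ** red_B B W s"
  define R where "R = red_C C V' s ** matrix_inv (red_K K V' W' s) ** transpose W'"
  define X where "X = (\<lambda>z. V *v (matrix_inv (red_K K V W s) *v (transpose W *v z)))"
  define X' where "X' = (\<lambda>z. V' *v (matrix_inv (red_K K V' W' s) *v (transpose W' *v z)))"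
  define T where "T = (\<lambda>x. x - X' (K s *v x))"
  define S where "S = (\<lambda>z. z - K s *v X z)"
  have X'_eq: "X' = (*v) (V' ** matrix_inv (red_K K V' W' s) ** transpose W')"
    by (simp add: X'_def fun_eq_iff matrix_vector_mul_assoc matrix_mul_assoc)
  have linX': "linear X'"
    unfolding X'_eq by (rule matrix_vector_mul_linear)
  have "T = (*v) (mat 1 - V' ** matrix_inv (red_K K V' W' s) ** transpose W' ** K s)"
    by (simp add: T_def X'_eq fun_eq_iff matrix_vector_mul_assoc matrix_vector_mult_diff_rdistrib)
  then have linT: "linear T"
    by (simp only: matrix_vector_mul_linear)
  have TV': "T v = 0" if v: "v \<in> Ran V'" for v
  proof -
    obtain a where a: "v = V' *v a" using v by (auto simp: Ran_def)
    have "transpose W' *v (K s *v v) = red_K K V' W' s *v a"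
      by (simp add: a red_K_def matrix_vector_mul_assoc matrix_mul_assoc)
    then show ?thesis
      by (simp add: T_def X'_def matrix_inv_vector_mult[OF Kr'] a)
  qed
  have normT: "norm (T x) \<le> norm x / ?cQ" for x
  proof (rule norm_oblique_projection_le[OF linT _ subspace_Ran TV' _ cos_Q])
    show "subspace (frak_Q K W' s)"
      by (simp add: frak_Q_def subspace_orth_compl_Ker)
    fix u assume u: "\<And>k. T k = k \<Longrightarrow> inner u k = 0"
    \<comment> \<open>On the kernel of \<open>transpose W' ** K s\<close> the map \<open>X'\<close>
      after \<open>K s\<close> vanishes, so \<open>T\<close> fixes every such
      \<open>k\<close>.\<close>
    have "inner u k = 0" if k: "(transpose W' ** K s) *v k = 0" for k
      by (rule u) (use k in \<open>simp add: T_def X'_def flip: matrix_vector_mul_assoc\<close>)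
    then show "u \<in> frak_Q K W' s"
      by (simp add: frak_Q_def mem_orth_compl_Ker_iff)
  qed
  have normTV: "norm (T x) \<le> ?sV / ?cQ * norm x" if x: "x \<in> Ran V" for x
  proof -
    \<comment> \<open>The angle provides points of \<open>Ran V\<close> near those of
      \<open>Ran V'\<close>; the symmetry of the gap for equal dimensions reverses this.\<close>
    obtain y where y: "y \<in> Ran V'" "norm (x - y) \<le> ?sV * norm x"
      using gap_symmetric[OF subspace_Ran subspace_Ran _
          ex_near_subspace_angle[OF subspace_Ran subspace_Ran] x, of V']
      by (auto simp: dim_Ran indep)
    have "T x = T (x - y)"
      using TV'[OF y(1)] by (simp add: linear_diff[OF linT])
    then have "norm (T x) \<le> norm (x - y) / ?cQ"
      using normT by simp
    also have "\<dots> \<le> ?sV * norm x / ?cQ"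
      using y cos_Q by (intro divide_right_mono) auto
    finally show ?thesis by simp
  qed
  have WS: "transpose W *v S z = 0" for z
  proof -
    have "transpose W *v (K s *v X z)
        = red_K K V W s *v (matrix_inv (red_K K V W s) *v (transpose W *v z))"
      by (simp add: X_def red_K_def matrix_vector_mul_assoc matrix_mul_assoc)
    then show ?thesis
      by (simp add: S_def matrix_vector_mult_diff_distrib matrix_inv_vector_mult[OF Kr])
  qed
  have normS: "norm (S z) \<le> norm z / ?cP" for z
  proof -
    have "inner (S z) y = 0" if "y \<in> left_space W" for y
      using that WS[of z] by (simp add: left_space_def mem_orth_compl_Ker_iff inner_commute[of "S z"])
    moreover have "K s *v X z \<in> frak_P K V s"
      unfolding frak_P_def Ran_def
    proof (rule range_eqI)
      show "K s *v X z = (K s ** V) *v (matrix_inv (red_K K V W s) *v (transpose W *v z))"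
        by (simp add: X_def matrix_vector_mul_assoc matrix_mul_assoc)
    qed
    \<comment> \<open>The two vectors add up to \<open>z\<close>, so the cosine bound applies to
      \<open>S\<close> directly, without passing to an adjoint.\<close>
    ultimately have "?cP * norm (S z) \<le> norm (S z + K s *v X z)"
      by (intro cos_angle_mult_norm_le)
        (simp_all add: frak_P_def left_space_def subspace_Ran subspace_orth_compl_Ker)
    then show ?thesis
      using cos_P by (simp add: S_def field_simps)
  qed
  have normR: "norm (R *v e) \<le> spectral_norm R * (?sW * norm e)" if e: "transpose W *v e = 0" for e
  proof -
    \<comment> \<open>\<open>R\<close> annihilates the kernel of \<open>transpose W'\<close>, so
      only the component \<open>w\<close> of \<open>e\<close> in \<open>left_space W'\<close>
      contributes.\<close>
    obtain k w where k: "k \<in> span (Ker (transpose W'))"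
      and w: "\<And>y. y \<in> span (Ker (transpose W')) \<Longrightarrow> orthogonal w y" and kw: "e = k + w"
      using orthogonal_subspace_decomp_exists by blast
    have "k \<in> Ker (transpose W')"
      using k subspace_Ker span_eq_iff by metis
    then have Wk: "transpose W' *v k = 0" by (simp add: Ker_def)
    have wk: "inner w k = 0"
      using w[OF k] by (simp add: orthogonal_def)
    have "inner w y = 0" if "transpose W' *v y = 0" for y
      using w[OF span_base] that by (simp add: Ker_def orthogonal_def)
    then have "w \<in> left_space W'"
      by (simp add: left_space_def mem_orth_compl_Ker_iff)
    then obtain y where y: "y \<in> left_space W" "norm (w - y) \<le> ?sW * norm w"
      using ex_near_subspace_angle[of "left_space W'" "left_space W" w]
      by (auto simp: left_space_def subspace_orth_compl_Ker)
    \<comment> \<open>Orthogonality of \<open>e\<close> to \<open>left_space W\<close> allows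
      \<open>w\<close> to be replaced by \<open>w - y\<close> in the inner product with
      \<open>e\<close>; this is where the sine enters.\<close>
    have "inner y e = 0"
      using y(1) e by (simp add: left_space_def mem_orth_compl_Ker_iff)
    then have "norm w * norm w = inner (w - y) e"
      by (simp add: kw inner_add_right inner_diff_left wk dot_square_norm power2_eq_square)
    also have "\<dots> \<le> norm (w - y) * norm e"
      by (rule norm_cauchy_schwarz)
    also have "\<dots> \<le> ?sW * norm w * norm e"
      using y by (intro mult_right_mono) auto
    finally have "norm w * norm w \<le> (?sW * norm e) * norm w"
      by (simp add: mult_ac)
    moreover have "0 \<le> ?sW"
      by (intro sin_subspace_angle_nonneg) (auto simp: left_space_def subspace_orth_compl_Ker)
    ultimately have nw: "norm w \<le> ?sW * norm e"
      by (cases "w = 0") auto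
    have "R *v e = R *v w"
      by (simp add: kw R_def matrix_vector_right_distrib Wk flip: matrix_vector_mul_assoc)
    then have "norm (R *v e) \<le> spectral_norm R * norm w"
      by (simp add: norm_matrix_vector_mult_le)
    also have "\<dots> \<le> spectral_norm R * (?sW * norm e)"
      using nw by (intro mult_left_mono spectral_norm_nonneg)
    finally show ?thesis .
  qed
  have RX': "R *v z = C s *v X' z" for z
    by (simp add: R_def X'_def red_C_def matrix_vector_mul_assoc matrix_mul_assoc)
  have LX: "L *v u = X (B s *v u)" for u
    by (simp add: L_def X_def red_B_def matrix_vector_mul_assoc matrix_mul_assoc)
  have HL: "red_H K B C V W s *v u = C s *v (L *v u)" for u
    by (simp add: L_def red_H_def red_C_def matrix_vector_mul_assoc matrix_mul_assoc)
  have HR: "red_H K B C V' W' s *v u = R *v (B s *v u)" for u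
    by (simp add: R_def red_H_def red_B_def matrix_vector_mul_assoc matrix_mul_assoc)
  have "norm ((red_H K B C V W s - red_H K B C V' W' s) *v u)
      \<le> (?cC / ?cQ * ?sV * ?H + ?cB / ?cP * ?sW * ?H') * norm u" for u
  proof -
    \<comment> \<open>Both terms contain \<open>C s\<close> applied to
      \<open>X' (K s *v X (B s *v u))\<close>, and these contributions cancel.\<close>
    have "(red_H K B C V W s - red_H K B C V' W' s) *v u
        = C s *v T (L *v u) - R *v S (B s *v u)"
      by (simp add: matrix_vector_mult_diff_rdistrib HL HR T_def S_def LX RX'
          matrix_vector_mult_diff_distrib linear_diff[OF linX'])
    then have "norm ((red_H K B C V W s - red_H K B C V' W' s) *v u)
        \<le> norm (C s *v T (L *v u)) + norm (R *v S (B s *v u))"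
      by (simp add: norm_triangle_ineq4)
    also have "norm (C s *v T (L *v u)) \<le> spectral_norm (C s) * norm (T (L *v u))"
      by (rule norm_matrix_vector_mult_le)
    also have "\<dots> \<le> spectral_norm (C s) * (?sV / ?cQ * norm (L *v u))"
    proof (intro mult_left_mono spectral_norm_nonneg normTV)
      show "L *v u \<in> Ran V"
        by (simp add: LX X_def Ran_def)
    qed
    also have "\<dots> \<le> spectral_norm (C s) * (?sV / ?cQ * (spectral_norm L * norm u))"
      using cos_Q sin_subspace_angle_nonneg[OF subspace_Ran[of V'] subspace_Ran[of V]]
      by (intro mult_left_mono spectral_norm_nonneg norm_matrix_vector_mult_le divide_nonneg_pos)
    \<comment> \<open>The factor \<open>?H\<close> cancels the denominator of \<open>cond_C\<close>,
      which is nonzero by \<open>H\<close>.\<close>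
    also have "\<dots> = ?cC / ?cQ * ?sV * ?H * norm u"
      using spectral_norm_pos[OF H] by (simp add: cond_C_def L_def)
    also have "norm (R *v S (B s *v u)) \<le> spectral_norm R * (?sW * norm (S (B s *v u)))"
      by (rule normR[OF WS])
    also have "\<dots> \<le> spectral_norm R * (?sW * (spectral_norm (B s) * norm u / ?cP))"
    proof (intro mult_left_mono spectral_norm_nonneg)
      have "norm (S (B s *v u)) \<le> norm (B s *v u) / ?cP"
        by (rule normS)
      also have "\<dots> \<le> spectral_norm (B s) * norm u / ?cP"
        using cos_P by (intro divide_right_mono norm_matrix_vector_mult_le) auto
      finally show "norm (S (B s *v u)) \<le> spectral_norm (B s) * norm u / ?cP" .
      show "0 \<le> ?sW"
        by (intro sin_subspace_angle_nonneg) (auto simp: left_space_def subspace_orth_compl_Ker)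
    qed
    also have "\<dots> = ?cB / ?cP * ?sW * ?H' * norm u"
      using spectral_norm_pos[OF H'] by (simp add: cond_B_def R_def)
    finally show ?thesis
      by (simp add: distrib_right)
  qed
  then show ?thesis by (rule spectral_norm_le)
qed

section \<open>From the pointwise estimate to suprema over the imaginary axis\<close>

theorem theorem3p3:
  fixes K :: "complex \<Rightarrow> complex^'n^'n"
    and B :: "complex \<Rightarrow> complex^'m^'n"
    and C :: "complex \<Rightarrow> complex^'n^'p"
    and \<sigma> \<mu> :: "'r::finite \<Rightarrow> complex"
    and b :: "'r \<Rightarrow> complex^'m"
    and c :: "'r \<Rightarrow> complex^'p"
    and V V' W W' :: "complex^'r^'n"
  assumes K_axis: "\<And>\<omega>::real. invertible (K (\<i> * of_real \<omega>))"
    and K_sigma: "\<And>j. invertible (K (\<sigma> j))"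
    and K_mu: "\<And>i. invertible (K (\<mu> i))"
    and V_exact: "\<And>j. K (\<sigma> j) *v column j V = B (\<sigma> j) *v b j"
    and W_exact: "\<And>i. column i W v* K (\<mu> i) = c i v* C (\<mu> i)"
    and indep: "independent_columns V" "independent_columns V'"
      "independent_columns W" "independent_columns W'"
    and Kr: "\<And>\<omega>::real. invertible (red_K K V W (\<i> * of_real \<omega>))"
    and Kr': "\<And>\<omega>::real. invertible (red_K K V' W' (\<i> * of_real \<omega>))"
    and Hr: "\<And>\<omega>::real. red_H K B C V W (\<i> * of_real \<omega>) \<noteq> 0"
    and Hr': "\<And>\<omega>::real. red_H K B C V' W' (\<i> * of_real \<omega>) \<noteq> 0"
    and Hr_bdd: "bdd_above (range (\<lambda>\<omega>::real. spectral_norm (red_H K B C V W (\<i> * of_real \<omega>))))"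
    and Hr'_bdd: "bdd_above (range (\<lambda>\<omega>::real. spectral_norm (red_H K B C V' W' (\<i> * of_real \<omega>))))"
    and cond_C_bdd: "bdd_above (range (\<lambda>\<omega>::real. cond_C K B C V W (\<i> * of_real \<omega>)))"
    and cond_B_bdd: "bdd_above (range (\<lambda>\<omega>::real. cond_B K B C V' W' (\<i> * of_real \<omega>)))"
    and cos_Q_pos: "0 < (INF \<omega>::real. cos (subspace_angle (frak_Q K W' (\<i> * of_real \<omega>)) (Ran V')))"
    and cos_P_pos: "0 < (INF \<omega>::real. cos (subspace_angle (frak_P K V (\<i> * of_real \<omega>)) (left_space W)))"
    and M_def: "M = 2 * max
        ((SUP \<omega>::real. cond_C K B C V W (\<i> * of_real \<omega>))
          / (INF \<omega>::real. cos (subspace_angle (frak_Q K W' (\<i> * of_real \<omega>)) (Ran V'))))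
        ((SUP \<omega>::real. cond_B K B C V' W' (\<i> * of_real \<omega>))
          / (INF \<omega>::real. cos (subspace_angle (frak_P K V (\<i> * of_real \<omega>)) (left_space W))))"
  shows "hinf_norm (\<lambda>s. red_H K B C V W s - red_H K B C V' W' s)
      / (1 / 2 * (hinf_norm (red_H K B C V W) + hinf_norm (red_H K B C V' W')))
    \<le> M * max (sin (subspace_angle (Ran V') (Ran V)))
              (sin (subspace_angle (left_space W') (left_space W)))"
proof -
  let ?s = "\<lambda>\<omega>::real. \<i> * of_real \<omega>"
  let ?H = "red_H K B C V W" and ?H' = "red_H K B C V' W'"
  let ?cosQ = "\<lambda>\<omega>::real. cos (subspace_angle (frak_Q K W' (?s \<omega>)) (Ran V'))"
  let ?cosP = "\<lambda>\<omega>::real. cos (subspace_angle (frak_P K V (?s \<omega>)) (left_space W))"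
  let ?cC = "SUP \<omega>::real. cond_C K B C V W (?s \<omega>)" and ?cQ = "INF \<omega>. ?cosQ \<omega>"
  let ?cB = "SUP \<omega>::real. cond_B K B C V' W' (?s \<omega>)" and ?cP = "INF \<omega>. ?cosP \<omega>"
  let ?sV = "sin (subspace_angle (Ran V') (Ran V))"
  let ?sW = "sin (subspace_angle (left_space W') (left_space W))"
  let ?m = "max ?sV ?sW"
  have sV: "0 \<le> ?sV"
    by (intro sin_subspace_angle_nonneg subspace_Ran)
  have sW: "0 \<le> ?sW"
    by (intro sin_subspace_angle_nonneg) (auto simp: left_space_def subspace_orth_compl_Ker)
  have H_le: "spectral_norm (?H (?s \<omega>)) \<le> hinf_norm ?H" for \<omega>
    unfolding hinf_norm_def by (intro cSUP_upper Hr_bdd) simp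
  have H'_le: "spectral_norm (?H' (?s \<omega>)) \<le> hinf_norm ?H'" for \<omega>
    unfolding hinf_norm_def by (intro cSUP_upper Hr'_bdd) simp
  \<comment> \<open>The nonzero value at \<omega> = 0 already makes both norms positive, so the
    quotient can be cleared at the end.\<close>
  have H_pos: "0 < hinf_norm ?H" "0 < hinf_norm ?H'"
    using H_le[of 0] H'_le[of 0] spectral_norm_pos[OF Hr[of 0]] spectral_norm_pos[OF Hr'[of 0]]
    by linarith+
  have cosQ: "?cQ \<le> ?cosQ \<omega>" for \<omega>
    by (intro cINF_lower bdd_belowI2[of _ "-1"]) auto
  have cosP: "?cP \<le> ?cosP \<omega>" for \<omega>
    by (intro cINF_lower bdd_belowI2[of _ "-1"]) auto
  have condC: "cond_C K B C V W (?s \<omega>) \<le> ?cC" for \<omega>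
    by (intro cSUP_upper cond_C_bdd) simp
  have condB: "cond_B K B C V' W' (?s \<omega>) \<le> ?cB" for \<omega>
    by (intro cSUP_upper cond_B_bdd) simp
  have condC0: "0 \<le> cond_C K B C V W (?s \<omega>)" for \<omega>
    by (simp add: cond_C_def spectral_norm_nonneg)
  have condB0: "0 \<le> cond_B K B C V' W' (?s \<omega>)" for \<omega>
    by (simp add: cond_B_def spectral_norm_nonneg)
  have CQ0: "0 \<le> ?cC / ?cQ" and BP0: "0 \<le> ?cB / ?cP"
    using order_trans[OF condC0 condC] order_trans[OF condB0 condB] cos_Q_pos cos_P_pos by simp_all
  have M0: "0 \<le> M"
    unfolding M_def using CQ0 by (simp add: le_max_iff_disj)
  \<comment> \<open>Half of \<open>M\<close> is the larger quotient. The factor 2 in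
    \<open>M\<close> compensates the 1/2 of the mean of the two norms.\<close>
  have CM: "?cC / ?cQ \<le> M / 2" and BM: "?cB / ?cP \<le> M / 2"
    by (simp_all add: M_def)
  have diff: "spectral_norm (?H (?s \<omega>) - ?H' (?s \<omega>))
      \<le> M * ?m * (1 / 2 * (hinf_norm ?H + hinf_norm ?H'))" for \<omega>
  proof -
    \<comment> \<open>Replacing the numerator by its supremum and the denominator by its positive
      infimum only enlarges the fraction, and makes the bound independent of \<omega>.\<close>
    have cQ: "cond_C K B C V W (?s \<omega>) / ?cosQ \<omega> \<le> M / 2"
      using order_trans[OF frac_le[OF order_trans[OF condC0 condC] condC cos_Q_pos cosQ] CM] .
    have cP: "cond_B K B C V' W' (?s \<omega>) / ?cosP \<omega> \<le> M / 2"
      using order_trans[OF frac_le[OF order_trans[OF condB0 condB] condB cos_P_pos cosP] BM] .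
    have "spectral_norm (?H (?s \<omega>) - ?H' (?s \<omega>))
      \<le> cond_C K B C V W (?s \<omega>) / ?cosQ \<omega> * ?sV * spectral_norm (?H (?s \<omega>))
        + cond_B K B C V' W' (?s \<omega>) / ?cosP \<omega> * ?sW * spectral_norm (?H' (?s \<omega>))"
      by (rule spectral_norm_red_H_diff_le[OF indep(1,2) Kr Kr' Hr Hr'
            less_le_trans[OF cos_Q_pos cosQ] less_le_trans[OF cos_P_pos cosP]])
    also have "\<dots> \<le> M / 2 * ?m * hinf_norm ?H + M / 2 * ?m * hinf_norm ?H'"
      using sV sW M0 H_pos
      by (intro add_mono mult_mono cQ cP H_le H'_le mult_nonneg_nonneg spectral_norm_nonneg)
        (auto simp: le_max_iff_disj)
    also have "\<dots> = M * ?m * (1 / 2 * (hinf_norm ?H + hinf_norm ?H'))"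
      by (simp add: algebra_simps)
    finally show ?thesis .
  qed
  have "hinf_norm (\<lambda>s. ?H s - ?H' s) \<le> M * ?m * (1 / 2 * (hinf_norm ?H + hinf_norm ?H'))"
    unfolding hinf_norm_def[of "\<lambda>s. ?H s - ?H' s"] by (rule cSUP_least[OF UNIV_not_empty diff])
  then show ?thesis
    using H_pos by (subst pos_divide_le_eq) auto
qed

end
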